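(* Let $d$ be a fixed positive integer. Then: (1) $(\beta_n^d/n^d)_n$ is a sequence in $[0,1]$ with $\limsup_{n\to\infty}\frac{\beta_n^d}{n^d}=1$; (2) $\beta_n^d=\mathcal{O}(n^d)$, but $\beta_n^d$ is not $\mathcal{O}(n^{d-\epsilon})$ for any $\epsilon>0$.
   Context: $\mathbb{Z}_n$ is the ring of integers modulo $n$, identified with $\{0,\dots,n-1\}$; a vector $(v_1,\dots,v_d)\in\mathbb{Z}_n^d$ is zero-sum-free if no non-empty subset of its components sums to $0$ in $\mathbb{Z}_n$; $\beta_n^d$ is the number of zero-sum-free $(x_1,\dots,x_d)\in\mathbb{Z}_n^d$ with $\gcd(x_1,\dots,x_d,n)=1$. $a_n=\mathcal{O}(b_n)$ means there are a constant $K>0$ and an integer $N$ with $|a_n|\leq K b_n$ for all $n\geq N$. *)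

theory Defs
  imports
    "HOL-Analysis.Analysis"
    "HOL-Library.Landau_Symbols"
    "HOL-Number_Theory.Cong"
begin

text \<open>
  A vector of \<open>\<int>\<^sub>n\<^sup>d\<close> is an extensional function from \<open>{1..d}\<close> to the representatives \<open>{0..<n}\<close>.
  Subsets of the components are subsets of the index set, so that equal entries at different
  positions count separately.
\<close>

definition zn_vectors :: "nat \<Rightarrow> nat \<Rightarrow> (nat \<Rightarrow> nat) set" where
  "zn_vectors n d = {1..d} \<rightarrow>\<^sub>E {0..<n}"

definition zero_sum_free :: "nat \<Rightarrow> nat \<Rightarrow> (nat \<Rightarrow> nat) \<Rightarrow> bool" where
  "zero_sum_free n d v \<longleftrightarrow> (\<forall>I. I \<subseteq> {1..d} \<and> I \<noteq> {} \<longrightarrow> \<not> [(\<Sum>i\<in>I. v i) = 0] (mod n))"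

definition zsf_count :: "nat \<Rightarrow> nat \<Rightarrow> nat" where
  "zsf_count n d =
     card {x \<in> zn_vectors n d. zero_sum_free n d x \<and> Gcd (insert n (x ` {1..d})) = 1}"

end

theory Submission
  imports Defs
begin

text \<open>
  For each non-empty index set \<open>I\<close> at most \<open>n ^ (d - 1)\<close> vectors satisfy \<open>(\<Sum>i\<in>I. v i) = 0\<close> in
  \<open>\<int>\<^sub>n\<close>, because one component in \<open>I\<close> is determined by all the other components. Hence all but
  at most \<open>2 ^ d * n ^ (d - 1)\<close> vectors are zero-sum-free. If \<open>n\<close> is prime, then the gcd condition
  follows from zero-sum-freeness, so along the primes the ratio is at least \<open>1 - 2 ^ d / n\<close>.
\<close>

lemma Gcd_insert_prime_eq_1_iff:
  fixes p :: "'a :: semiring_Gcd"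
  assumes "prime p"
  shows "Gcd (insert p A) = 1 \<longleftrightarrow> (\<exists>a\<in>A. \<not> p dvd a)"
proof -
  have "Gcd (insert p A) = 1 \<longleftrightarrow> coprime p (Gcd A)"
    by (simp add: coprime_iff_gcd_eq_1)
  also have "\<dots> \<longleftrightarrow> \<not> p dvd Gcd A"
    using assms by (meson coprime_absorb_left not_prime_unit prime_imp_coprime)
  finally show ?thesis
    by (simp add: dvd_Gcd_iff)
qed

lemma card_PiE_determined_coordinate_le:
  assumes "finite I" "\<And>i. i \<in> I \<Longrightarrow> finite (B i)" and S: "S \<subseteq> Pi\<^sub>E I B"
    and determined: "\<And>v w. \<lbrakk>v \<in> S; w \<in> S; \<And>i. i \<in> I - {k} \<Longrightarrow> v i = w i\<rbrakk> \<Longrightarrow> v k = w k"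
  shows "card S \<le> (\<Prod>i\<in>I - {k}. card (B i))"
proof -
  have "inj_on (\<lambda>v. restrict v (I - {k})) S"
  proof (rule inj_onI)
    fix v w
    assume vw: "v \<in> S" "w \<in> S" and "restrict v (I - {k}) = restrict w (I - {k})"
    then have agree: "v i = w i" if "i \<in> I - {k}" for i
      using that by (metis restrict_apply')
    show "v = w"
    proof (rule PiE_ext)
      show "v \<in> Pi\<^sub>E I B" "w \<in> Pi\<^sub>E I B"
        using vw S by auto
      show "v i = w i" if "i \<in> I" for i
        using that agree determined[OF vw agree] by (cases "i = k") auto
    qed
  qed
  moreover have "(\<lambda>v. restrict v (I - {k})) ` S \<subseteq> Pi\<^sub>E (I - {k}) B"
  proof (rule image_subsetI)
    fix v
    assume "v \<in> S"
    then have "v \<in> Pi\<^sub>E I B"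
      using S by blast
    then show "restrict v (I - {k}) \<in> Pi\<^sub>E (I - {k}) B"
      by (simp add: PiE_iff)
  qed
  moreover have "finite (Pi\<^sub>E (I - {k}) B)"
    using assms(1,2) by (intro finite_PiE) auto
  ultimately have "card S \<le> card (Pi\<^sub>E (I - {k}) B)"
    by (rule card_inj_on_le)
  then show ?thesis
    using assms(1) by (simp add: card_PiE)
qed

lemma cong_coordinate_if_cong_sum:
  fixes v w :: "'i \<Rightarrow> nat"
  assumes "finite I" "k \<in> I" "[(\<Sum>i\<in>I. v i) = (\<Sum>i\<in>I. w i)] (mod n)"
    and agree: "\<And>i. i \<in> I - {k} \<Longrightarrow> v i = w i"
  shows "[v k = w k] (mod n)"
proof -
  have "(\<Sum>i\<in>I - {k}. v i) = (\<Sum>i\<in>I - {k}. w i)"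
    by (rule sum.cong[OF refl agree])
  then show ?thesis
    using assms(3) by (simp add: sum.remove[OF assms(1,2)] cong_add_rcancel_nat)
qed

lemma limsup_eq_if_subseq_tendsto:
  fixes u :: "nat \<Rightarrow> 'a :: {complete_linorder, linorder_topology}"
  assumes "strict_mono r" "(\<lambda>k. u (r k)) \<longlonglongrightarrow> l" "\<And>n. u n \<le> l"
  shows "limsup u = l"
proof (rule antisym)
  show "limsup u \<le> l"
    using assms(3) by (intro Limsup_bounded) simp
  have "limsup (u \<circ> r) = l"
    using assms(2) by (intro lim_imp_Limsup) (simp_all add: o_def)
  then show "l \<le> limsup u"
    using limsup_subseq_mono[OF assms(1), of u] by simp
qed

lemma not_bigo_if_subseq_ratio_tendsto_nonzero:
  fixes f g h :: "nat \<Rightarrow> 'a :: real_normed_field"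
  assumes "g \<in> o(h)" "strict_mono r" "(\<lambda>k. f (r k) / h (r k)) \<longlonglongrightarrow> l" "l \<noteq> 0"
  shows "f \<notin> O(g)"
proof
  assume "f \<in> O(g)"
  then have "f \<in> o(h)"
    using assms(1) by (rule landau_o.big_small_trans)
  then have "(\<lambda>k. f (r k) / h (r k)) \<longlonglongrightarrow> 0"
    using LIMSEQ_subseq_LIMSEQ[OF smalloD_tendsto assms(2)] by (simp add: o_def)
  then show False
    using assms(3,4) LIMSEQ_unique by blast
qed

lemma real_powr_diff_smallo_power:
  fixes \<epsilon> :: real
  assumes "\<epsilon> > 0"
  shows "(\<lambda>n. real n powr (real d - \<epsilon>)) \<in> o(\<lambda>n. real n ^ d)"
proof -
  have "(\<lambda>n. real n powr (real d - \<epsilon>)) \<in> o(\<lambda>n. real n powr real d)"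
    using assms by (simp add: powr_smallo_iff filterlim_real_sequentially)
  also have "(\<lambda>n. real n powr real d) \<in> \<Theta>(\<lambda>n. real n ^ d)"
    by (intro bigthetaI_cong eventually_mono[OF eventually_gt_at_top[of 0]])
       (simp add: powr_realpow)
  finally show ?thesis .
qed

lemma finite_zn_vectors [simp]: "finite (zn_vectors n d)"
  by (simp add: zn_vectors_def finite_PiE)

lemma card_zn_vectors [simp]: "card (zn_vectors n d) = n ^ d"
  by (simp add: zn_vectors_def card_PiE)

definition sum_fibre :: "nat \<Rightarrow> nat \<Rightarrow> nat set \<Rightarrow> nat \<Rightarrow> (nat \<Rightarrow> nat) set" where
  "sum_fibre n d I a = {v \<in> zn_vectors n d. [(\<Sum>i\<in>I. v i) = a] (mod n)}"

lemma card_sum_fibre_le: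
  assumes "I \<subseteq> {1..d}" "I \<noteq> {}"
  shows "card (sum_fibre n d I a) \<le> n ^ (d - 1)"
proof -
  obtain k where k: "k \<in> I"
    using assms(2) by blast
  have "card (sum_fibre n d I a) \<le> (\<Prod>i\<in>{1..d} - {k}. card {0..<n})"
  proof (rule card_PiE_determined_coordinate_le)
    show "sum_fibre n d I a \<subseteq> {1..d} \<rightarrow>\<^sub>E {0..<n}"
      by (auto simp: sum_fibre_def zn_vectors_def)
    fix v w
    assume v: "v \<in> sum_fibre n d I a" and w: "w \<in> sum_fibre n d I a"
      and agree: "\<And>i. i \<in> {1..d} - {k} \<Longrightarrow> v i = w i"
    have "[(\<Sum>i\<in>I. v i) = (\<Sum>i\<in>I. w i)] (mod n)"
      using v w by (simp add: sum_fibre_def cong_def)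
    then have "[v k = w k] (mod n)"
      using assms(1) k agree finite_subset
      by (intro cong_coordinate_if_cong_sum[of I k v w n]) auto
    moreover have "v k < n" "w k < n"
      using v w k assms(1) by (auto simp: sum_fibre_def zn_vectors_def)
    ultimately show "v k = w k"
      by (rule cong_less_modulus_unique_nat)
  qed (use k assms(1) in auto)
  also have "\<dots> = n ^ (d - 1)"
    using k assms(1) by (simp add: card_Diff_singleton subset_iff)
  finally show ?thesis .
qed

definition zero_sum_free_vectors :: "nat \<Rightarrow> nat \<Rightarrow> (nat \<Rightarrow> nat) set" where
  "zero_sum_free_vectors n d = {v \<in> zn_vectors n d. zero_sum_free n d v}"

lemma zn_vectors_eq_zero_sum_free_Un_sum_fibres:
  "zn_vectors n d =
    zero_sum_free_vectors n d \<union> (\<Union>I\<in>Pow {1..d} - {{}}. sum_fibre n d I 0)"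
  by (auto simp: zero_sum_free_vectors_def zero_sum_free_def sum_fibre_def)

lemma card_zero_sum_free_vectors_ge:
  "n ^ d \<le> card (zero_sum_free_vectors n d) + 2 ^ d * n ^ (d - 1)"
proof -
  define Idx where "Idx = Pow {1..d} - {{}}"
  have "card Idx \<le> card (Pow {1..d})"
    unfolding Idx_def by (intro card_mono) auto
  then have card_Idx: "card Idx \<le> 2 ^ d"
    by (simp add: card_Pow)
  have "card (\<Union>I\<in>Idx. sum_fibre n d I 0) \<le> (\<Sum>I\<in>Idx. card (sum_fibre n d I 0))"
    by (rule card_UN_le) (simp add: Idx_def)
  also have "\<dots> \<le> (\<Sum>I\<in>Idx. n ^ (d - 1))"
    by (intro sum_mono card_sum_fibre_le) (auto simp: Idx_def)
  also have "\<dots> \<le> 2 ^ d * n ^ (d - 1)"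
    using card_Idx by simp
  finally have "card (\<Union>I\<in>Idx. sum_fibre n d I 0) \<le> 2 ^ d * n ^ (d - 1)" .
  moreover have "n ^ d \<le> card (zero_sum_free_vectors n d) + card (\<Union>I\<in>Idx. sum_fibre n d I 0)"
    unfolding card_zn_vectors[symmetric] zn_vectors_eq_zero_sum_free_Un_sum_fibres[of n d] Idx_def
    by (rule card_Un_le)
  ultimately show ?thesis
    by linarith
qed

lemma zsf_count_le: "zsf_count n d \<le> n ^ d"
  unfolding zsf_count_def card_zn_vectors[symmetric] by (intro card_mono) auto

lemma zsf_count_bigo: "(\<lambda>n. real (zsf_count n d)) \<in> O(\<lambda>n. real n ^ d)"
  using zsf_count_le by (intro bigoI[where c = 1] always_eventually) (simp flip: of_nat_power)

lemma zsf_count_prime: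
  assumes "prime p" "d \<ge> 1"
  shows "zsf_count p d = card (zero_sum_free_vectors p d)"
proof -
  have "Gcd (insert p (v ` {1..d})) = 1" if "zero_sum_free p d v" for v
  proof -
    have "\<not> p dvd v 1"
      using that[unfolded zero_sum_free_def, rule_format, of "{1}"] assms(2)
      by (simp add: cong_0_iff)
    then have "\<exists>a\<in>v ` {1..d}. \<not> p dvd a"
      using assms(2) by (intro bexI[of _ "v 1"]) auto
    then show ?thesis
      using Gcd_insert_prime_eq_1_iff[OF assms(1)] by blast
  qed
  then show ?thesis
    unfolding zsf_count_def zero_sum_free_vectors_def by (intro arg_cong[where f = card]) auto
qed

definition zsf_density :: "nat \<Rightarrow> nat \<Rightarrow> real" where
  "zsf_density n d = real (zsf_count n d) / real n ^ d"

lemma zsf_density_in_unit_interval: "zsf_density n d \<in> {0..1}"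
  using zsf_count_le[of n d] by (auto simp: zsf_density_def divide_le_eq_1 simp flip: of_nat_power)

lemma zsf_density_prime_ge:
  assumes "prime p" "d \<ge> 1"
  shows "1 - 2 ^ d / real p \<le> zsf_density p d"
proof -
  have p: "real p > 0"
    using assms(1) prime_gt_0_nat by simp
  have power_d: "real p ^ d = real p * real p ^ (d - 1)"
    using assms(2) by (simp add: power_eq_if)
  have "p ^ d \<le> zsf_count p d + 2 ^ d * p ^ (d - 1)"
    using card_zero_sum_free_vectors_ge by (simp add: zsf_count_prime[OF assms])
  then have "real (p ^ d) \<le> real (zsf_count p d + 2 ^ d * p ^ (d - 1))"
    by (rule of_nat_mono)
  then have "real p ^ d - 2 ^ d * real p ^ (d - 1) \<le> real (zsf_count p d)"
    by simp
  moreover have "(1 - 2 ^ d / real p) * real p ^ d = real p ^ d - 2 ^ d * real p ^ (d - 1)"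
    using p by (simp add: power_d left_diff_distrib)
  ultimately show ?thesis
    using p by (simp add: zsf_density_def pos_le_divide_eq)
qed

lemma strict_mono_enumerate_primes: "strict_mono (enumerate {p :: nat. prime p})"
  using primes_infinite by (rule strict_mono_enumerate)

lemma zsf_density_tendsto_1_along_primes:
  assumes "d \<ge> 1"
  shows "(\<lambda>k. zsf_density (enumerate {p. prime p} k) d) \<longlonglongrightarrow> 1"
proof (rule tendsto_sandwich)
  let ?p = "enumerate {p :: nat. prime p}"
  have "(\<lambda>n. 1 - 2 ^ d / real n) \<longlonglongrightarrow> 1 - 0"
    by (intro tendsto_diff tendsto_const lim_const_over_n)
  then show "(\<lambda>k. 1 - 2 ^ d / real (?p k)) \<longlonglongrightarrow> 1"
    using LIMSEQ_subseq_LIMSEQ[OF _ strict_mono_enumerate_primes] by (fastforce simp: o_def)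
  have "prime (?p k)" for k
    using enumerate_in_set[OF primes_infinite] by blast
  then show "\<forall>\<^sub>F k in sequentially. 1 - 2 ^ d / real (?p k) \<le> zsf_density (?p k) d"
    using assms by (simp add: zsf_density_prime_ge)
  show "\<forall>\<^sub>F k in sequentially. zsf_density (?p k) d \<le> 1"
    using zsf_density_in_unit_interval by simp
qed (rule tendsto_const)

theorem theorem6p3:
  fixes d :: nat
  assumes "d \<ge> 1"
  shows "((\<forall>n\<ge>1. real (zsf_count n d) / real n ^ d \<in> {0..1}) \<and>
          limsup (\<lambda>n. ereal (real (zsf_count n d) / real n ^ d)) = 1) \<and>
         ((\<lambda>n. real (zsf_count n d)) \<in> O(\<lambda>n. real n ^ d) \<and>
          (\<forall>\<epsilon>::real. \<epsilon> > 0 \<longrightarrow>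
             (\<lambda>n. real (zsf_count n d)) \<notin> O(\<lambda>n. real n powr (real d - \<epsilon>))))"
proof -
  note along_primes = zsf_density_tendsto_1_along_primes[OF assms]
  have "limsup (\<lambda>n. ereal (zsf_density n d)) = 1"
  proof (rule limsup_eq_if_subseq_tendsto[OF strict_mono_enumerate_primes])
    show "(\<lambda>k. ereal (zsf_density (enumerate {p. prime p} k) d)) \<longlonglongrightarrow> 1"
      using along_primes by (simp add: one_ereal_def)
    show "ereal (zsf_density n d) \<le> 1" for n
      using zsf_density_in_unit_interval[of n d] by simp
  qed
  moreover have "(\<lambda>n. real (zsf_count n d)) \<notin> O(\<lambda>n. real n powr (real d - \<epsilon>))"
    if "\<epsilon> > 0" for \<epsilon> :: real
    using not_bigo_if_subseq_ratio_tendsto_nonzero[OF real_powr_diff_smallo_power[OF that]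
        strict_mono_enumerate_primes along_primes[unfolded zsf_density_def]]
    by simp
  ultimately show ?thesis
    using zsf_density_in_unit_interval zsf_count_bigo by (simp add: zsf_density_def)
qed

end
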